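(* Consider the adversarial-order secretary problem with an $\alpha$-power signal (defined in the context), where $\alpha=\alpha(n)>0$ may depend on $n$, and let $n\to\infty$. If $\alpha=o(n)$, then $\mathrm{OPT}^{\mathrm{det}}_n(\alpha)=o(1)$. If $\alpha/n\to c\in(0,\infty)$, then $\mathrm{OPT}^{\mathrm{det}}_n(\alpha)\to1-e^{-c}$.
   Context: Notation: $[n]=\{1,\dots,n\}$. Adversarial-order secretary problem with an $\alpha$-power signal ($\alpha>0$ real): an adversary fixes an instance, i.e. a value vector $v\in\mathbb{N}_0^n$ with a unique maximum entry, located at a time $i^\star\in[n]$. Items arrive one by one at times $1,\dots,n$ in this order. A signal time $S\in[i^\star]$ is drawn with $$\Pr[S=s]=\frac{s^\alpha-(s-1)^\alpha}{(i^\star)^\alpha},\qquad s\in[i^\star].$$ At each time $t$ the policy observes $v_t$ and whether the content-free signal occurs at time $t$ ($S=t$); it then irrevocably decides whether to stop at time $t$. The policy knows $n$ and $\alpha$, but not the instance. It succeeds if it stops exactly at time $i^\star$. A deterministic policy uses no internal randomness: its decision at time $t$ is a function of the observations up to time $t$. The worst-case success probability of a policy is the infimum over all instances of length $n$ of its success probability (over the signal); $\mathrm{OPT}^{\mathrm{det}}_n(\alpha)$ is the supremum of the worst-case success probability over all deterministic policies. *)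

theory Defs
  imports "HOL-Probability.Probability" "HOL-Library.Landau_Symbols"
begin

definition is_unique_max :: "nat \<Rightarrow> (nat \<Rightarrow> nat) \<Rightarrow> nat \<Rightarrow> bool" where
  "is_unique_max n v i \<longleftrightarrow> i \<in> {1..n} \<and> (\<forall>j\<in>{1..n} - {i}. v j < v i)"

text \<open>A value vector of length \<open>n\<close> is a function of which only the entries at times
  \<open>1, \<dots>, n\<close> matter: nothing below inspects the others.\<close>

definition instances :: "nat \<Rightarrow> (nat \<Rightarrow> nat) set" where
  "instances n = {v. \<exists>i. is_unique_max n v i}"

definition best_time :: "nat \<Rightarrow> (nat \<Rightarrow> nat) \<Rightarrow> nat" where
  "best_time n v = (THE i. is_unique_max n v i)"

lemma best_time_eq:
  assumes "is_unique_max n v i"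
  shows "best_time n v = i"
  unfolding best_time_def
proof (rule the_equality[where P = "is_unique_max n v", OF assms])
  fix j assume j: "is_unique_max n v j"
  show "j = i"
  proof (rule ccontr)
    assume "j \<noteq> i"
    with assms j have "v j < v i" "v i < v j"
      by (auto simp: is_unique_max_def)
    thus False by simp
  qed
qed

definition signal_mass :: "real \<Rightarrow> nat \<Rightarrow> nat \<Rightarrow> real" where
  "signal_mass \<alpha> i s =
     (if s \<in> {1..i} then (real s powr \<alpha> - (real s - 1) powr \<alpha>) / real i powr \<alpha> else 0)"

text \<open>The law of the signal time when the maximum is at time \<open>i\<close>. It is specified only for
  \<open>\<alpha> > 0\<close> and \<open>i \<ge> 1\<close>; see the lemma \<open>pmf_signal_pmf\<close>.\<close>

definition signal_pmf :: "real \<Rightarrow> nat \<Rightarrow> nat pmf" where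
  "signal_pmf \<alpha> i = embed_pmf (signal_mass \<alpha> i)"

lemma signal_mass_nonneg:
  assumes "\<alpha> > 0"
  shows "signal_mass \<alpha> i s \<ge> 0"
  using assms by (auto simp: signal_mass_def intro!: divide_nonneg_nonneg powr_mono2)

lemma sum_signal_mass:
  assumes "\<alpha> > 0" "i \<ge> 1"
  shows "(\<Sum>s\<in>{1..i}. signal_mass \<alpha> i s) = 1"
proof -
  have tele: "(\<Sum>s\<in>{1..k}. real s powr \<alpha> - (real s - 1) powr \<alpha>) = real k powr \<alpha>" for k :: nat
    by (induction k) auto
  have "(\<Sum>s\<in>{1..i}. signal_mass \<alpha> i s)
      = (\<Sum>s\<in>{1..i}. (real s powr \<alpha> - (real s - 1) powr \<alpha>) / real i powr \<alpha>)"
    by (intro sum.cong) (auto simp: signal_mass_def)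
  also have "\<dots> = 1"
    unfolding sum_divide_distrib[symmetric] tele using assms by simp
  finally show ?thesis .
qed

lemma pmf_signal_pmf:
  assumes "\<alpha> > 0" "i \<ge> 1"
  shows "pmf (signal_pmf \<alpha> i) s = signal_mass \<alpha> i s"
  unfolding signal_pmf_def
proof (rule pmf_embed_pmf)
  show "0 \<le> signal_mass \<alpha> i x" for x
    using assms(1) by (rule signal_mass_nonneg)
  have "(\<integral>\<^sup>+ x. ennreal (signal_mass \<alpha> i x) \<partial>count_space UNIV)
      = (\<Sum>s\<in>{1..i}. ennreal (signal_mass \<alpha> i s))"
    by (rule nn_integral_count_space') (auto simp: signal_mass_def)
  also have "\<dots> = ennreal (\<Sum>s\<in>{1..i}. signal_mass \<alpha> i s)"
    using assms(1) by (intro sum_ennreal signal_mass_nonneg)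
  also have "\<dots> = 1"
    using sum_signal_mass[OF assms] by simp
  finally show "(\<integral>\<^sup>+ x. ennreal (signal_mass \<alpha> i x) \<partial>count_space UNIV) = 1" .
qed

text \<open>A deterministic policy maps the observation history at the current time (one entry per
  time, earliest first: the value, and whether the signal occurred at that time) to the decision
  whether to stop now.\<close>

type_synonym policy = "(nat \<times> bool) list \<Rightarrow> bool"

definition history :: "(nat \<Rightarrow> nat) \<Rightarrow> nat \<Rightarrow> nat \<Rightarrow> (nat \<times> bool) list" where
  "history v s t = map (\<lambda>k. (v k, s = k)) [1..<Suc t]"

text \<open>The policy stops at the first time at which it decides to stop, and possibly never.\<close>

definition stops_at :: "policy \<Rightarrow> (nat \<Rightarrow> nat) \<Rightarrow> nat \<Rightarrow> nat \<Rightarrow> bool" where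
  "stops_at \<pi> v s t \<longleftrightarrow> \<pi> (history v s t) \<and> (\<forall>k\<in>{1..<t}. \<not> \<pi> (history v s k))"

definition success_prob :: "nat \<Rightarrow> real \<Rightarrow> policy \<Rightarrow> (nat \<Rightarrow> nat) \<Rightarrow> real" where
  "success_prob n \<alpha> \<pi> v =
     measure_pmf.prob (signal_pmf \<alpha> (best_time n v)) {s. stops_at \<pi> v s (best_time n v)}"

definition worst_case_success :: "nat \<Rightarrow> real \<Rightarrow> policy \<Rightarrow> real" where
  "worst_case_success n \<alpha> \<pi> = (INF v\<in>instances n. success_prob n \<alpha> \<pi> v)"

text \<open>The set of instances is nonempty for \<open>n \<ge> 1\<close>, and all success probabilities lie in the
  unit interval, so infimum and supremum are the intended ones.\<close>

definition OPT_det :: "nat \<Rightarrow> real \<Rightarrow> real" where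
  "OPT_det n \<alpha> = (SUP \<pi>. worst_case_success n \<alpha> \<pi>)"

end

theory Submission
  imports Defs "HOL-Real_Asymp.Real_Asymp"
begin

text \<open>
  Stopping at the signal succeeds with probability \<open>1 - (1 - 1/i)\<^sup>\<alpha>\<close> when the maximum is at
  time \<open>i\<close>, which is smallest for \<open>i = n\<close>. Conversely, let the \<open>i\<close>-th instance take the values
  \<open>1, \<dots>, i, 0, \<dots>, 0\<close>. Up to time \<open>i\<close> it is indistinguishable from the increasing sequence, so
  that each signal time \<open>s\<close> leads to success on at most one of these \<open>n\<close> instances. In terms of the
  weights \<open>s\<^sup>\<alpha> - (s - 1)\<^sup>\<alpha>\<close>, whose total is \<open>n\<^sup>\<alpha>\<close>, a success probability at least \<open>p\<close> on each of
  them gives \<open>p \<Sum>\<^sub>i i\<^sup>\<alpha> \<le> n\<^sup>\<alpha>\<close>. If \<open>\<alpha>/n\<close> tends to \<open>c \<ge> 0\<close>, then \<open>(1 - j/n)\<^sup>\<alpha>\<close> tends to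
  \<open>e\<^sup>-\<^sup>c\<^sup>j\<close> for every \<open>j\<close>, and both bounds tend to \<open>1 - e\<^sup>-\<^sup>c\<close>.
\<close>

text \<open>The condition on \<open>s\<close> sits inside the summand, so the index range does not
  depend on \<open>A\<close>; sums for different events can then be extended to a common range and
  swapped.\<close>

lemma signal_prob_eq_sum:
  assumes "\<alpha> > 0" "i \<ge> 1"
  shows "measure_pmf.prob (signal_pmf \<alpha> i) A =
           (\<Sum>s\<in>{1..i}. if s \<in> A then signal_mass \<alpha> i s else 0)"
proof -
  have supp: "set_pmf (signal_pmf \<alpha> i) \<subseteq> {1..i}"
    using assms by (auto simp: set_pmf_eq pmf_signal_pmf signal_mass_def split: if_splits)
  have "measure_pmf.prob (signal_pmf \<alpha> i) A = measure_pmf.prob (signal_pmf \<alpha> i) ({1..i} \<inter> A)"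
    using supp by (intro measure_prob_cong_0) (auto simp: set_pmf_eq)
  also have "\<dots> = (\<Sum>s\<in>{1..i} \<inter> A. signal_mass \<alpha> i s)"
    using assms by (simp add: measure_measure_pmf_finite pmf_signal_pmf)
  also have "\<dots> = (\<Sum>s\<in>{1..i}. if s \<in> A then signal_mass \<alpha> i s else 0)"
    by (simp add: sum.inter_restrict)
  finally show ?thesis .
qed

lemma success_prob_bounds: "success_prob n \<alpha> \<pi> v \<in> {0..1}"
  by (simp add: success_prob_def)

definition ramp :: "nat \<Rightarrow> nat \<Rightarrow> nat" where
  "ramp i k = (if k \<le> i then k else 0)"

lemma is_unique_max_ramp: "i \<in> {1..n} \<Longrightarrow> is_unique_max n (ramp i) i"
  by (auto simp: is_unique_max_def ramp_def)

lemma ramp_in_instances: "i \<in> {1..n} \<Longrightarrow> ramp i \<in> instances n"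
  using is_unique_max_ramp by (auto simp: instances_def)

lemma history_ramp: "k \<le> i \<Longrightarrow> history (ramp i) s k = history (\<lambda>k. k) s k"
  by (auto simp: history_def ramp_def)

lemma stops_at_ramp: "stops_at \<pi> (ramp i) s i \<longleftrightarrow> stops_at \<pi> (\<lambda>k. k) s i"
  by (auto simp: stops_at_def history_ramp)

lemma stops_at_unique:
  assumes "stops_at \<pi> v s i" "stops_at \<pi> v s j" "i \<ge> 1" "j \<ge> 1"
  shows "i = j"
  using assms by (cases i j rule: linorder_cases) (auto simp: stops_at_def)

lemma worst_case_success_le_success_prob:
  assumes "v \<in> instances n"
  shows "worst_case_success n \<alpha> \<pi> \<le> success_prob n \<alpha> \<pi> v"
  unfolding worst_case_success_def
  by (intro cINF_lower assms bdd_belowI2[where m = 0]) (use success_prob_bounds in auto)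

lemma worst_case_success_le:
  assumes "\<alpha> > 0" "n \<ge> 1"
  shows "worst_case_success n \<alpha> \<pi> \<le> real n powr \<alpha> / (\<Sum>i\<in>{1..n}. real i powr \<alpha>)"
proof -
  define p where "p = worst_case_success n \<alpha> \<pi>"
  define w where "w = (\<lambda>s::nat. real s powr \<alpha> - (real s - 1) powr \<alpha>)"
  define X where "X = (\<lambda>i s. stops_at \<pi> (\<lambda>k. k) s i)"
  have w_nonneg: "w s \<ge> 0" if "s \<ge> 1" for s
    using that assms by (auto simp: w_def intro!: powr_mono2)
  have le: "p * real i powr \<alpha> \<le> (\<Sum>s\<in>{1..n}. if X i s then w s else 0)" if i: "i \<in> {1..n}" for i
  proof -
    have best: "best_time n (ramp i) = i"
      using i by (intro best_time_eq is_unique_max_ramp)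
    have "p \<le> success_prob n \<alpha> \<pi> (ramp i)"
      unfolding p_def using i by (intro worst_case_success_le_success_prob ramp_in_instances)
    also have "\<dots> = (\<Sum>s\<in>{1..i}. if X i s then signal_mass \<alpha> i s else 0)"
      using i assms by (simp add: success_prob_def best signal_prob_eq_sum stops_at_ramp X_def)
    also have "\<dots> = (\<Sum>s\<in>{1..i}. if X i s then w s else 0) / real i powr \<alpha>"
      by (auto simp: signal_mass_def w_def sum_divide_distrib intro!: sum.cong)
    \<comment> \<open>Clearing the normalisation leaves weights \<open>w s\<close> that are the same
      for all instances. They are nonnegative, so the range may grow to
      \<open>{1..n}\<close>.\<close>
    finally have "p * real i powr \<alpha> \<le> (\<Sum>s\<in>{1..i}. if X i s then w s else 0)"
      using i by (simp add: field_simps)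
    also have "\<dots> \<le> (\<Sum>s\<in>{1..n}. if X i s then w s else 0)"
      using i by (intro sum_mono2) (auto intro: w_nonneg)
    finally show ?thesis .
  qed
  have "p * (\<Sum>i\<in>{1..n}. real i powr \<alpha>) \<le> (\<Sum>i\<in>{1..n}. \<Sum>s\<in>{1..n}. if X i s then w s else 0)"
    unfolding sum_distrib_left by (intro sum_mono le)
  also have "\<dots> = (\<Sum>s\<in>{1..n}. \<Sum>i\<in>{1..n}. if X i s then w s else 0)"
    by (rule sum.swap)
  also have "\<dots> \<le> (\<Sum>s\<in>{1..n}. w s)"
  proof (rule sum_mono)
    fix s assume s: "s \<in> {1..n}"
    \<comment> \<open>With \<open>s\<close> fixed, the policy has at most one first stopping time on
      the identity sequence, so \<open>w s\<close> is charged to at most one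
      \<open>i\<close>.\<close>
    have "card {i\<in>{1..n}. X i s} \<le> 1"
      by (auto simp: card_le_Suc0_iff_eq X_def intro: stops_at_unique)
    hence "real (card {i\<in>{1..n}. X i s}) * w s \<le> 1 * w s"
      using s by (intro mult_right_mono w_nonneg) auto
    thus "(\<Sum>i\<in>{1..n}. if X i s then w s else 0) \<le> w s"
      by (simp flip: sum.inter_filter)
  qed
  also have "\<dots> = real n powr \<alpha>"
    unfolding w_def by (induction n) auto
  finally have "p * (\<Sum>i\<in>{1..n}. real i powr \<alpha>) \<le> real n powr \<alpha>" .
  moreover have "(\<Sum>i\<in>{1..n}. real i powr \<alpha>) > 0"
    using assms by (intro sum_pos) auto
  ultimately show ?thesis
    by (simp add: p_def field_simps)
qed

text \<open>Of the sum over all instances only the last \<open>J\<close> terms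
  \<open>i = n - j\<close> are kept. With \<open>J\<close> fixed, the limit in \<open>n\<close> can
  be taken term by term.\<close>

lemma OPT_det_le:
  assumes "\<alpha> > 0" "J \<ge> 1" "n \<ge> J"
  shows "OPT_det n \<alpha> \<le> 1 / (\<Sum>j<J. (1 - real j / real n) powr \<alpha>)"
proof -
  have pos: "(\<Sum>j<J. (1 - real j / real n) powr \<alpha>) > 0"
    using assms by (intro sum_pos) (auto simp: lessThan_empty_iff)
  \<comment> \<open>As \<open>j < J \<le> n\<close>, the truncated difference \<open>n - j\<close>
    agrees with the real one, is injective in \<open>j\<close> and stays in
    \<open>{1..n}\<close>.\<close>
  have "real n powr \<alpha> * (\<Sum>j<J. (1 - real j / real n) powr \<alpha>) = (\<Sum>j<J. real (n - j) powr \<alpha>)"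
    unfolding sum_distrib_left using assms
    by (intro sum.cong) (auto simp: of_nat_diff right_diff_distrib simp flip: powr_mult)
  also have "\<dots> = (\<Sum>i\<in>(\<lambda>j. n - j) ` {..<J}. real i powr \<alpha>)"
    using assms by (subst sum.reindex) (auto intro!: inj_onI)
  also have "\<dots> \<le> (\<Sum>i\<in>{1..n}. real i powr \<alpha>)"
    using assms by (intro sum_mono2) auto
  finally have le: "real n powr \<alpha> * (\<Sum>j<J. (1 - real j / real n) powr \<alpha>)
      \<le> (\<Sum>i\<in>{1..n}. real i powr \<alpha>)" .
  have "real n powr \<alpha> / (\<Sum>i\<in>{1..n}. real i powr \<alpha>)
      \<le> real n powr \<alpha> / (real n powr \<alpha> * (\<Sum>j<J. (1 - real j / real n) powr \<alpha>))"
    using assms pos by (intro divide_left_mono le mult_pos_pos sum_pos) auto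
  also have "\<dots> = 1 / (\<Sum>j<J. (1 - real j / real n) powr \<alpha>)"
    using assms by simp
  finally have "real n powr \<alpha> / (\<Sum>i\<in>{1..n}. real i powr \<alpha>) \<le> \<dots>" .
  with assms show ?thesis
    unfolding OPT_det_def
    by (intro cSUP_least order.trans[OF worst_case_success_le]) auto
qed

definition stop_at_signal :: policy where
  "stop_at_signal h = snd (last h)"

lemma stops_at_stop_at_signal:
  assumes "t \<ge> 1"
  shows "stops_at stop_at_signal v s t \<longleftrightarrow> s = t"
proof -
  have "stop_at_signal (history v s k) \<longleftrightarrow> s = k" if "k \<ge> 1" for k
    using that by (simp add: stop_at_signal_def history_def)
  thus ?thesis
    using assms by (auto simp: stops_at_def)
qed

lemma OPT_det_ge:
  assumes "\<alpha> > 0" "n \<ge> 1"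
  shows "1 - (1 - 1 / real n) powr \<alpha> \<le> OPT_det n \<alpha>"
proof -
  have ne: "instances n \<noteq> {}"
    using ramp_in_instances[of 1 n] assms by auto
  have "1 - (1 - 1 / real n) powr \<alpha> \<le> success_prob n \<alpha> stop_at_signal v"
    if v: "v \<in> instances n" for v
  proof -
    obtain i where "is_unique_max n v i"
      using v by (auto simp: instances_def)
    hence i: "i \<in> {1..n}" and best: "best_time n v = i"
      by (auto simp: is_unique_max_def best_time_eq)
    have "success_prob n \<alpha> stop_at_signal v = signal_mass \<alpha> i i"
      using i assms
      by (simp add: success_prob_def best stops_at_stop_at_signal measure_pmf_single pmf_signal_pmf)
    \<comment> \<open>For \<open>i = 1\<close> the base is \<open>0\<close> and
      \<open>0 powr \<alpha> = 0\<close>, so the formula correctly gives success with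
      certainty.\<close>
    also have "\<dots> = 1 - (1 - 1 / real i) powr \<alpha>"
      using i assms by (auto simp: signal_mass_def diff_divide_distrib simp flip: powr_divide)
    finally have *: "success_prob n \<alpha> stop_at_signal v = \<dots>" .
    have "(1 - 1 / real i) powr \<alpha> \<le> (1 - 1 / real n) powr \<alpha>"
      using i assms by (intro powr_mono2) (auto simp: field_simps)
    thus ?thesis unfolding * by simp
  qed
  hence "1 - (1 - 1 / real n) powr \<alpha> \<le> worst_case_success n \<alpha> stop_at_signal"
    unfolding worst_case_success_def using ne by (intro cINF_greatest)
  also have "\<dots> \<le> OPT_det n \<alpha>"
    unfolding OPT_det_def
  proof (rule cSUP_upper)
    \<comment> \<open>A single instance bounds all policies at once: no worst case exceeds the
      success probability on \<open>v\<close>, which is at most 1.\<close>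
    obtain v where "v \<in> instances n" using ne by auto
    thus "bdd_above (range (worst_case_success n \<alpha>))"
      using success_prob_bounds
      by (intro bdd_aboveI2[where M = 1] order.trans[OF worst_case_success_le_success_prob]) auto
  qed simp
  finally show ?thesis .
qed

text \<open>The exponent \<open>\<alpha> n * ln (1 - j / n)\<close> splits into two convergent
  factors: \<open>\<alpha> n / n\<close> tends to \<open>c\<close>, and
  \<open>n * ln (1 - j / n)\<close> tends to \<open>- j\<close>.\<close>

lemma tendsto_one_minus_powr:
  fixes \<alpha> :: "nat \<Rightarrow> real"
  assumes "(\<lambda>n. \<alpha> n / real n) \<longlonglongrightarrow> c"
  shows "(\<lambda>n. (1 - real j / real n) powr \<alpha> n) \<longlonglongrightarrow> exp (- c) ^ j"
proof -
  have "(\<lambda>n::nat. real n * ln (1 - real j / real n)) \<longlonglongrightarrow> - real j"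
    by real_asymp
  with assms have "(\<lambda>n. exp (\<alpha> n / real n * (real n * ln (1 - real j / real n))))
      \<longlonglongrightarrow> exp (c * - real j)"
    by (intro tendsto_intros)
  moreover have "\<forall>\<^sub>F n in sequentially. exp (\<alpha> n / real n * (real n * ln (1 - real j / real n)))
      = (1 - real j / real n) powr \<alpha> n"
    \<comment> \<open>The exponential form of \<open>powr\<close> needs a nonzero base, and
      cancelling \<open>n\<close> needs \<open>n \<noteq> 0\<close>; both hold for
      \<open>n > j\<close>.\<close>
    using eventually_gt_at_top[of j]
    by eventually_elim (auto simp: powr_def)
  ultimately show ?thesis
    by (auto simp: exp_of_nat_mult[symmetric] mult.commute elim: Lim_transform_eventually)
qed

text \<open>For \<open>q < 1\<close> this inverts the geometric series. At \<open>q = 1\<close>,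
  which is the case \<open>c = 0\<close>, the sum is \<open>J\<close> and its inverse tends to
  0.\<close>

lemma inverse_geometric_sum_tendsto:
  fixes q :: real
  assumes "0 < q" "q \<le> 1"
  shows "(\<lambda>J. 1 / (\<Sum>j<J. q ^ j)) \<longlonglongrightarrow> 1 - q"
proof (cases "q = 1")
  case True
  thus ?thesis using lim_1_over_n[where 'a = real] by simp
next
  case False
  hence "(\<lambda>J. \<Sum>j<J. q ^ j) \<longlonglongrightarrow> 1 / (1 - q)"
    using geometric_sums[of q] assms by (simp add: sums_def)
  hence "(\<lambda>J. 1 / (\<Sum>j<J. q ^ j)) \<longlonglongrightarrow> 1 / (1 / (1 - q))"
    using False by (intro tendsto_intros) auto
  thus ?thesis by simp
qed

lemma OPT_det_tendsto:
  fixes \<alpha> :: "nat \<Rightarrow> real"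
  assumes pos: "\<And>n. n \<ge> 1 \<Longrightarrow> \<alpha> n > 0" and c: "c \<ge> 0"
    and lim: "(\<lambda>n. \<alpha> n / real n) \<longlonglongrightarrow> c"
  shows "(\<lambda>n. OPT_det n (\<alpha> n)) \<longlonglongrightarrow> 1 - exp (- c)"
proof (rule order_tendstoI)
  fix a assume "a < 1 - exp (- c)"
  moreover have "(\<lambda>n. 1 - (1 - 1 / real n) powr \<alpha> n) \<longlonglongrightarrow> 1 - exp (- c)"
    using tendsto_diff[OF tendsto_const tendsto_one_minus_powr[OF lim, of 1]] by simp
  ultimately have "\<forall>\<^sub>F n in sequentially. a < 1 - (1 - 1 / real n) powr \<alpha> n"
    by (simp add: order_tendstoD)
  thus "\<forall>\<^sub>F n in sequentially. a < OPT_det n (\<alpha> n)"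
    using eventually_ge_at_top[of 1]
  proof eventually_elim
    case (elim n)
    thus ?case using OPT_det_ge[OF pos, of n n] by simp
  qed
next
  fix a assume "1 - exp (- c) < a"
  moreover have "(\<lambda>J. 1 / (\<Sum>j<J. exp (- c) ^ j)) \<longlonglongrightarrow> 1 - exp (- c)"
    using c by (intro inverse_geometric_sum_tendsto) auto
  ultimately have "\<forall>\<^sub>F J in sequentially. 1 / (\<Sum>j<J. exp (- c) ^ j) < a \<and> J \<ge> 1"
    by (intro eventually_conj eventually_ge_at_top) (simp add: order_tendstoD)
  \<comment> \<open>\<open>J\<close> depends only on \<open>a\<close> and \<open>c\<close> and is
    fixed before \<open>n\<close> grows; \<open>J \<ge> 1\<close> keeps the sum in the denominator
    positive.\<close>
  then obtain J where J: "1 / (\<Sum>j<J. exp (- c) ^ j) < a" "J \<ge> 1"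
    by (auto simp: eventually_sequentially)
  have "(\<Sum>j<J. exp (- c) ^ j) > 0"
    using J by (intro sum_pos) (auto simp: lessThan_empty_iff)
  hence "(\<lambda>n. 1 / (\<Sum>j<J. (1 - real j / real n) powr \<alpha> n)) \<longlonglongrightarrow> 1 / (\<Sum>j<J. exp (- c) ^ j)"
    by (intro tendsto_divide tendsto_const tendsto_sum tendsto_one_minus_powr lim) auto
  hence "\<forall>\<^sub>F n in sequentially. 1 / (\<Sum>j<J. (1 - real j / real n) powr \<alpha> n) < a"
    using J by (simp add: order_tendstoD)
  thus "\<forall>\<^sub>F n in sequentially. OPT_det n (\<alpha> n) < a"
    using eventually_ge_at_top[of J]
  proof eventually_elim
    case (elim n)
    have "OPT_det n (\<alpha> n) \<le> 1 / (\<Sum>j<J. (1 - real j / real n) powr \<alpha> n)"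
      using elim J pos by (intro OPT_det_le) auto
    with elim show ?case by simp
  qed
qed

theorem corollary7:
  fixes \<alpha> :: "nat \<Rightarrow> real"
  assumes "\<And>n. n \<ge> 1 \<Longrightarrow> \<alpha> n > 0"
  shows "(\<alpha> \<in> o(\<lambda>n. real n) \<longrightarrow> (\<lambda>n. OPT_det n (\<alpha> n)) \<in> o(\<lambda>_. 1)) \<and>
         (\<forall>c>0. (\<lambda>n. \<alpha> n / real n) \<longlonglongrightarrow> c \<longrightarrow>
                (\<lambda>n. OPT_det n (\<alpha> n)) \<longlonglongrightarrow> 1 - exp (- c))"
proof (intro conjI impI allI)
  assume "\<alpha> \<in> o(\<lambda>n. real n)"
  hence "(\<lambda>n. \<alpha> n / real n) \<longlonglongrightarrow> 0"
    by (rule smalloD_tendsto)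
  \<comment> \<open>Sublinear growth is the case \<open>c = 0\<close>, where the limit
    \<open>1 - exp (- 0)\<close> vanishes.\<close>
  hence "(\<lambda>n. OPT_det n (\<alpha> n)) \<longlonglongrightarrow> 1 - exp (- 0)"
    using assms by (intro OPT_det_tendsto) auto
  thus "(\<lambda>n. OPT_det n (\<alpha> n)) \<in> o(\<lambda>_. 1)"
    by (intro smalloI_tendsto) auto
next
  fix c :: real
  assume "c > 0" "(\<lambda>n. \<alpha> n / real n) \<longlonglongrightarrow> c"
  thus "(\<lambda>n. OPT_det n (\<alpha> n)) \<longlonglongrightarrow> 1 - exp (- c)"
    using assms by (intro OPT_det_tendsto) auto
qed

end
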